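(* Let $C\subseteq\mathbb{R}^q$ be a nontrivial convex cone, and let $A\in\mathcal{G}(\mathbb{R}^q,C)$ be nonempty, not self-bounded, but bounded with respect to $K$ for some nontrivial closed convex cone $K\subseteq\mathbb{R}^q$. Let a finite set $\bar{Y}\subseteq\mathbb{R}^q$ satisfy $\operatorname{conv}\bar{Y}+K\supseteq A$. Then $h(\operatorname{conv}\bar{Y}+K,\,A)=\infty$.
   Context: A subset $K\subseteq\mathbb{R}^q$ is a cone if $\lambda k\in K$ whenever $k\in K$ and $\lambda>0$. A convex cone is nontrivial if it is neither empty nor $\mathbb{R}^q$. Let $\mathcal{G}(\mathbb{R}^q,C):=\{A\subseteq\mathbb{R}^q : A=\operatorname{cl}\operatorname{conv}(A+C)\}$. The recession cone of $A$ is $\operatorname{recc}A=\{k\in\mathbb{R}^q : \forall a\in A,\ \forall\alpha\ge 0:\ a+\alpha k\in A\}$. For a cone $K$, the set $A$ is bounded with respect to $K$ if there exists $y\in\mathbb{R}^q$ with $y+K\supseteq A$. A nonempty set $A\in\mathcal{G}(\mathbb{R}^q,C)$ is self-bounded if $A\neq\mathbb{R}^q$ and $A$ is bounded with respect to $\operatorname{recc}A$. With $\|\cdot\|$ the Euclidean norm and $d(y,A):=\inf_{a\in A}\|y-a\|$, the Hausdorff distance between two closed sets is $h(A_1,A_2)=\max\{\sup_{a_1\in A_1}d(a_1,A_2),\ \sup_{a_2\in A_2}d(a_2,A_1)\}\in[0,\infty]$. *)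

theory Defs
  imports "HOL-Analysis.Analysis"
begin

text \<open>
  Closure under strictly positive scaling only: in contrast to the library's \<^const>\<open>cone\<close> and
  \<^const>\<open>conic\<close>, a nonempty set satisfying this need not contain the origin.
\<close>
definition is_cone :: "'a::real_vector set \<Rightarrow> bool" where
  "is_cone K \<longleftrightarrow> (\<forall>k\<in>K. \<forall>c>0. c *\<^sub>R k \<in> K)"

definition nontrivial_convex_cone :: "'a::real_vector set \<Rightarrow> bool" where
  "nontrivial_convex_cone K \<longleftrightarrow> is_cone K \<and> convex K \<and> K \<noteq> {} \<and> K \<noteq> UNIV"

text \<open>Between sets, \<open>+\<close> is the Minkowski sum.\<close>
definition upper_closed_convex_sets :: "'a::real_normed_vector set \<Rightarrow> 'a set set" where
  "upper_closed_convex_sets C = {A. A = closure (convex hull (A + C))}"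

definition recc :: "'a::real_vector set \<Rightarrow> 'a set" where
  "recc A = {k. \<forall>a\<in>A. \<forall>\<alpha>\<ge>0. a + \<alpha> *\<^sub>R k \<in> A}"

definition bounded_wrt :: "'a::ab_group_add set \<Rightarrow> 'a set \<Rightarrow> bool" where
  "bounded_wrt K A \<longleftrightarrow> (\<exists>y. A \<subseteq> {y} + K)"

text \<open>Meant for nonempty closed convex \<open>A\<close>.\<close>
definition self_bounded :: "'a::real_vector set \<Rightarrow> bool" where
  "self_bounded A \<longleftrightarrow> A \<noteq> UNIV \<and> bounded_wrt (recc A) A"

text \<open>
  The distances take values in \<open>[0, \<infinity>]\<close>; the library's real-valued \<^const>\<open>infdist\<close> is not used,
  as a supremum of real numbers could not be infinite.
\<close>
definition point_set_dist :: "'a::real_normed_vector \<Rightarrow> 'a set \<Rightarrow> ennreal" where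
  "point_set_dist y A = (INF a\<in>A. ennreal (norm (y - a)))"

definition hausdorff_dist :: "'a::real_normed_vector set \<Rightarrow> 'a set \<Rightarrow> ennreal" where
  "hausdorff_dist A1 A2 =
     max (SUP a1\<in>A1. point_set_dist a1 A2) (SUP a2\<in>A2. point_set_dist a2 A1)"

end

theory Submission
  imports Defs
begin

text \<open>
  If the distance were finite, every ray \<open>y + t k\<close> with \<open>k \<in> K\<close> and \<open>y \<in> Y\<close> would stay within
  bounded distance of the closed convex set \<open>A\<close>, which makes \<open>k\<close> a recession direction of \<open>A\<close>.
  Then \<open>K \<subseteq> recc A\<close>, so boundedness of \<open>A\<close> with respect to \<open>K\<close> is inherited by \<open>recc A\<close>,
  and \<open>A\<close> would be self-bounded.
\<close>

text \<open>For \<open>b\<close> in \<open>A\<close> within \<open>M\<close> of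
  \<open>y + t *\<^sub>R k\<close>, the point of the segment from \<open>a\<close> to
  \<open>b\<close> with weight \<open>\<alpha> / t\<close> on \<open>b\<close> tends to
  \<open>a + \<alpha> *\<^sub>R k\<close> as \<open>t\<close> grows; closedness keeps the limit in
  \<open>A\<close>.\<close>

lemma ray_near_closed_convex_imp_mem_recc:
  fixes A :: "'a::real_normed_vector set"
  assumes "closed A" "convex A"
    and near: "\<And>t. t > 0 \<Longrightarrow> \<exists>b\<in>A. norm (y + t *\<^sub>R k - b) \<le> M"
  shows "k \<in> recc A"
  unfolding recc_def
proof (intro CollectI ballI allI impI)
  fix a and \<alpha> :: real
  assume a: "a \<in> A" and \<alpha>: "\<alpha> \<ge> 0"
  have "\<exists>x\<in>A. dist x (a + \<alpha> *\<^sub>R k) < e" if e: "e > 0" for e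
  proof -
    \<comment> \<open>\<open>R\<close> bounds the error before scaling by
      \<open>\<alpha> / t\<close>. The choice of \<open>t\<close> makes this weight at most 1 and
      the scaled error less than \<open>e\<close>; the summand 1 keeps \<open>t\<close> positive
      when \<open>\<alpha> = 0\<close>.\<close>
    define R where "R = \<bar>M\<bar> + norm (y - a)"
    define t where "t = \<alpha> + \<alpha> * R / e + 1"
    have R: "R \<ge> 0" by (simp add: R_def)
    have frac: "\<alpha> * R / e \<ge> 0" using R \<alpha> e by simp
    have t: "t > 0" "\<alpha> \<le> t" using frac \<alpha> by (auto simp: t_def)
    have "\<alpha> * R / e < t" using \<alpha> by (simp add: t_def)
    then have small: "\<alpha> / t * R < e" using e t by (simp add: field_simps)
    obtain b where b: "b \<in> A" "norm (y + t *\<^sub>R k - b) \<le> M"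
      using near t by blast
    let ?x = "(1 - \<alpha> / t) *\<^sub>R a + (\<alpha> / t) *\<^sub>R b"
    have "?x \<in> A"
      using \<open>convex A\<close> a b \<alpha> t by (intro convexD) auto
    moreover have "dist ?x (a + \<alpha> *\<^sub>R k) < e"
    proof -
      have "?x - (a + \<alpha> *\<^sub>R k) = (\<alpha> / t) *\<^sub>R ((y - a) - (y + t *\<^sub>R k - b))"
        using t by (simp add: algebra_simps)
      then have "dist ?x (a + \<alpha> *\<^sub>R k) = \<alpha> / t * norm ((y - a) - (y + t *\<^sub>R k - b))"
        using \<alpha> t by (simp add: dist_norm)
      also have "\<dots> \<le> \<alpha> / t * R"
        using b(2) norm_triangle_ineq4[of "y - a" "y + t *\<^sub>R k - b"] \<alpha> t
        by (intro mult_left_mono) (auto simp: R_def)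
      finally show ?thesis using small by simp
    qed
    ultimately show ?thesis by blast
  qed
  then show "a + \<alpha> *\<^sub>R k \<in> A"
    using closed_approachable[OF \<open>closed A\<close>] by blast
qed

lemma hausdorff_dist_finite_imp_near:
  assumes "hausdorff_dist P A \<noteq> \<infinity>"
  obtains M where "\<And>p. p \<in> P \<Longrightarrow> \<exists>a\<in>A. norm (p - a) \<le> M"
proof -
  obtain M where M: "M \<ge> 0" "hausdorff_dist P A = ennreal M"
    using assms by (cases "hausdorff_dist P A") auto
  \<comment> \<open>The infimum need not be attained; the slack 1 makes the bound strict and so
    yields a witness.\<close>
  have "\<exists>a\<in>A. norm (p - a) \<le> M + 1" if "p \<in> P" for p
  proof -
    have "point_set_dist p A \<le> ennreal M"
      unfolding M(2)[symmetric] hausdorff_dist_def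
      using that by (intro max.coboundedI1 SUP_upper)
    also have "\<dots> < ennreal (M + 1)"
      using M(1) by (simp add: ennreal_less_iff)
    finally obtain a where "a \<in> A" "ennreal (norm (p - a)) < ennreal (M + 1)"
      unfolding point_set_dist_def INF_less_iff by blast
    then show ?thesis by (auto simp: ennreal_less_iff intro: less_imp_le)
  qed
  then show thesis by (rule that)
qed

text \<open>Translation by \<open>y\<close> is a bijection of the space. This serves to rule out
  \<open>A = UNIV\<close>, the other way to fail to be self-bounded.\<close>

lemma bounded_wrt_UNIV_iff: "bounded_wrt K UNIV \<longleftrightarrow> K = UNIV"
proof
  assume "bounded_wrt K UNIV"
  then obtain y where "\<And>x. x \<in> {y} + K"
    unfolding bounded_wrt_def by blast
  then have "x \<in> K" for x
    using set_plus_elim[of "y + x" "{y}" K] by auto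
  then show "K = UNIV" by blast
next
  assume "K = UNIV"
  have "x \<in> {0} + K" for x
    using set_plus_intro[of 0 "{0}" x K] \<open>K = UNIV\<close> by simp
  then show "bounded_wrt K UNIV" unfolding bounded_wrt_def by blast
qed

theorem proposition3p9:
  fixes C A K Y :: "(real ^ 'q) set"
  assumes "nontrivial_convex_cone C"
    and "A \<in> upper_closed_convex_sets C"
    and "A \<noteq> {}"
    and "\<not> self_bounded A"
    and "nontrivial_convex_cone K"
    and "closed K"
    and "bounded_wrt K A"
    and "finite Y"
    and "A \<subseteq> (convex hull Y) + K"
  shows "hausdorff_dist ((convex hull Y) + K) A = \<infinity>"
proof (rule ccontr)
  assume "hausdorff_dist ((convex hull Y) + K) A \<noteq> \<infinity>"
  then obtain M where M: "\<And>p. p \<in> (convex hull Y) + K \<Longrightarrow> \<exists>a\<in>A. norm (p - a) \<le> M"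
    by (rule hausdorff_dist_finite_imp_near) metis
  have A: "A = closure (convex hull (A + C))"
    using assms(2) by (simp add: upper_closed_convex_sets_def)
  have "closed A" by (subst A) simp
  have "convex A" by (subst A) (simp add: convex_closure)
  \<comment> \<open>A base point for the rays exists because the nonempty \<open>A\<close> is
    covered by the sum.\<close>
  obtain y where y: "y \<in> convex hull Y"
    using assms(3,9) by (metis all_not_in_conv set_plus_elim subsetD)
  have K: "is_cone K" "K \<noteq> UNIV"
    using assms(5) by (auto simp: nontrivial_convex_cone_def)
  have "K \<subseteq> recc A"
  proof
    fix k assume "k \<in> K"
    \<comment> \<open>\<open>is_cone\<close> scales by positive factors only, which matches the
      range of \<open>t\<close> in the ray lemma.\<close>
    then have "y + t *\<^sub>R k \<in> (convex hull Y) + K" if "t > 0" for t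
      using K(1) y that unfolding is_cone_def by (intro set_plus_intro) simp_all
    then show "k \<in> recc A"
      using \<open>closed A\<close> \<open>convex A\<close> M
      by (intro ray_near_closed_convex_imp_mem_recc[where y = y and M = M]) simp_all
  qed
  then have "{z} + K \<subseteq> {z} + recc A" for z
    by (intro set_plus_mono2) auto
  then have "bounded_wrt (recc A) A"
    using assms(7) unfolding bounded_wrt_def by (meson order_trans)
  moreover have "A \<noteq> UNIV"
    using assms(7) K(2) bounded_wrt_UNIV_iff by metis
  ultimately show False
    using assms(4) by (simp add: self_bounded_def)
qed

end
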